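(* Let $c\in\mathbb C$ have real part $a$. The set $R(c)=\{\sigma_c(n)\colon n\in\mathbb N\}$ is a bounded subset of $\mathbb C$ if and only if $a<-1$.
   Context: $\mathbb N$ is the set of positive integers. For $c\in\mathbb C$, the divisor function $\sigma_c\colon\mathbb N\to\mathbb C$ is $\sigma_c(n)=\sum_{d\mid n}d^c$ (sum over positive divisors $d$ of $n$), where $d^c=e^{c\log d}$ with the real logarithm $\log d$. *)

theory Defs
  imports "HOL-Analysis.Analysis"
begin

(* At n = 0 the index set is infinite, so divisor_sigma c 0 = 0 is a junk value;
   sigma_range ranges over positive n only. *)
definition divisor_sigma :: "complex \<Rightarrow> nat \<Rightarrow> complex" where
  "divisor_sigma c n = (\<Sum>d | d dvd n. of_nat d powr c)"

definition sigma_range :: "complex \<Rightarrow> complex set" where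
  "sigma_range c = {divisor_sigma c n | n. n > 0}"

(* Complex powr uses the principal complex logarithm; on positive integers this is
   the real logarithm. *)
lemma of_nat_powr_eq_exp_ln:
  fixes c :: complex and d :: nat
  assumes "d > 0"
  shows "of_nat d powr c = exp (c * complex_of_real (ln (real d)))"
  using assms by (simp add: powr_def Ln_of_nat)

end

theory Submission
  imports Defs "HOL-Computational_Algebra.Primes"
begin

text \<open>
  For \<open>a < -1\<close> the triangle inequality bounds the divisor function by the convergent series of
  \<open>d powr a\<close>.

  Let \<open>a \<ge> -1\<close> and \<open>b = Im c\<close>. On a product of distinct primes the divisor function is the product of
  the factors \<open>1 + p powr c\<close>, and \<open>Re (p powr c) = p powr a * cos (b * ln p)\<close>. Using only primes with
  \<open>cos (b * ln p) > 0\<close>, each factor has modulus at least \<open>1 + cos (b * ln p) / p\<close>, so the modulus of the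
  product is at least the sum of these \<open>cos (b * ln p) / p\<close>. It remains to see that this sum is unbounded
  (\<open>prime_positive_cos_sum_unbounded\<close>): the points \<open>b * ln p\<close> must not avoid the right half of the
  circle.

  Elementary bounds of Chebyshev type for primes in intervals are too coarse when \<open>b\<close> is large, so the
  zeta function enters, but only through two simple facts. As \<open>s\<close> decreases to \<open>1\<close>, \<open>\<zeta>(s)\<close> is unbounded
  (\<open>zeta_unbounded_above_one\<close>) while \<open>\<zeta>(s + i t)\<close> stays bounded for every fixed \<open>t \<noteq> 0\<close>
  (\<open>zeta_bounded_above_one\<close>). By the Euler product (\<open>euler_product_tendsto\<close>) the sum of \<open>p powr - s\<close>
  is then unbounded, and the sums of \<open>p powr - s * cos (t * ln p)\<close> are bounded from above.

  The non-vanishing of \<open>\<zeta>\<close> on the line of real part \<open>1\<close>, which would bound the last sums from below as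
  well, is avoided by a choice of trigonometric polynomial. A combination of \<open>cos (k * t)\<close>, \<open>k \<ge> 1\<close>, with
  nonnegative coefficients needs only the upper bounds. The combination in \<open>trig_majorant\<close> is moreover
  at least \<open>1\<close> wherever \<open>cos t \<le> 0\<close>. If the primes with \<open>cos (b * ln p) > 0\<close> contributed only a
  bounded amount, the unbounded sum of \<open>p powr - s\<close> would therefore be dominated by bounded sums.
\<close>

section \<open>A trigonometric inequality with positive coefficients\<close>

text \<open>
  With \<open>x = cos t\<close> the four cosines are Chebyshev polynomials in \<open>x\<close>, and their combination
  minus \<open>1\<close> factors as \<open>x (1 + x) q(x)\<close> with a cubic \<open>q\<close> that is negative on \<open>[-1, 0]\<close>; hence
  the combination is at least \<open>1\<close> wherever \<open>cos t \<le> 0\<close>. Where \<open>cos t > 0\<close> a large multiple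
  of the positive part of \<open>cos t\<close> compensates. Three features matter later: the coefficients of
  the frequencies \<open>2, 3, 4, 5\<close> are positive, there is no constant term on the right, and yet the
  lower bound is a positive constant. The weights \<open>5, 8, 6, 2\<close> are close to proportional to those
  that maximize, among nonnegative weights of given sum on frequencies up to \<open>5\<close>, the minimum over
  \<open>cos t \<le> 0\<close>.
\<close>
lemma trig_majorant:
  fixes t :: real
  shows "1 \<le> 5 * cos (2 * t) + 8 * cos (3 * t) + 6 * cos (4 * t) + 2 * cos (5 * t) + 100 * max 0 (cos t)"
proof -
  define x where "x = cos t"
  have x: "-1 \<le> x" "x \<le> 1"
    by (auto simp: x_def)
  have c2: "cos (2 * t) = 2 * x ^ 2 - 1"
    by (simp add: x_def cos_double_cos)
  have c3: "cos (3 * t) = 4 * x ^ 3 - 3 * x"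
    using cos_treble_cos[of t] by (simp add: x_def)
  have c4: "cos (4 * t) = 2 * (2 * x ^ 2 - 1) ^ 2 - 1"
    using cos_double_cos[of "2 * t"] by (simp add: c2)
  have "cos (5 * t) + cos t = 2 * cos (3 * t) * cos (2 * t)"
    using cos_add[of "3 * t" "2 * t"] cos_diff[of "3 * t" "2 * t"] by (simp add: algebra_simps)
  hence c5: "cos (5 * t) = 2 * (4 * x ^ 3 - 3 * x) * (2 * x ^ 2 - 1) - x"
    by (simp add: c2 c3 x_def)
  have P: "5 * cos (2 * t) + 8 * cos (3 * t) + 6 * cos (4 * t) + 2 * cos (5 * t) - 1 =
        x * (1 + x) * (32 * x ^ 3 + 16 * x ^ 2 - 24 * x - 14)" (is "?P - 1 = _")
    unfolding c2 c3 c4 c5 by algebra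
  show ?thesis
  proof (cases "x \<le> 0")
    case True
    \<comment> \<open>The cubic has its maximum on \<open>[-1, 0]\<close> near \<open>-11/16\<close>; splitting off a square
      from its negative there leaves a linear remainder that is positive on the interval.\<close>
    have "32 * x ^ 3 + 16 * x ^ 2 - 24 * x - 14 =
        - ((x + 11/16) ^ 2 * (28 - 32 * x) + (49/64 + 5/8 * x))"
      by (simp add: field_simps power2_eq_square power3_eq_cube)
    also have "(x + 11/16) ^ 2 * (28 - 32 * x) \<ge> 0"
      using True by (intro mult_nonneg_nonneg) auto
    hence "- ((x + 11/16) ^ 2 * (28 - 32 * x) + (49/64 + 5/8 * x)) \<le> 0"
      using x by linarith
    finally have "x * (1 + x) * (32 * x ^ 3 + 16 * x ^ 2 - 24 * x - 14) \<ge> 0"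
      using True x by (intro mult_nonpos_nonpos) (auto intro: mult_nonpos_nonneg)
    thus ?thesis
      using P by (simp add: x_def)
  next
    case False
    have "32 * x ^ 3 + 16 * x ^ 2 - 24 * x - 14 \<ge> - 24 * x - 14"
      using False by simp
    hence "32 * x ^ 3 + 16 * x ^ 2 - 24 * x - 14 \<ge> -30 - 8"
      using x by linarith
    moreover have "0 \<le> x * (1 + x)"  "x * (1 + x) \<le> x * 2"
      using False x by auto
    ultimately have "x * (1 + x) * (32 * x ^ 3 + 16 * x ^ 2 - 24 * x - 14) \<ge> x * (1 + x) * (- 38)"
      by (intro mult_left_mono) auto
    hence "x * (1 + x) * (32 * x ^ 3 + 16 * x ^ 2 - 24 * x - 14) \<ge> - 76 * x"
      using \<open>x * (1 + x) \<le> x * 2\<close> by linarith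
    thus ?thesis
      using P False by (simp add: x_def)
  qed
qed

section \<open>The Euler product\<close>

text \<open>
  The sieve of Eratosthenes on Dirichlet series: by complete multiplicativity the terms divisible
  by \<open>p\<close> add up to \<open>f p\<close> times the whole sum, so striking them out multiplies the sum by
  \<open>1 - f p\<close>.
\<close>
lemma infsum_coprime_to_primes:
  fixes f :: "nat \<Rightarrow> 'a :: {real_normed_field, banach}"
  assumes mult: "\<And>m n. f (m * n) = f m * f n"
    and summable: "f summable_on UNIV"
    and "finite S" and "\<And>p. p \<in> S \<Longrightarrow> prime p"
  shows "(\<Sum>\<^sub>\<infinity>n | n > 0 \<and> (\<forall>p\<in>S. \<not> p dvd n). f n) = (\<Prod>p\<in>S. 1 - f p) * (\<Sum>\<^sub>\<infinity>n | n > 0. f n)"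
  using assms(3,4)
proof (induction S rule: finite_induct)
  case (insert p S)
  define A where "A = {n. n > 0 \<and> (\<forall>q\<in>S. \<not> q dvd n)}"
  have p: "prime p" and S: "\<And>q. q \<in> S \<Longrightarrow> prime q"
    using insert.prems by auto
  have "p > 0"
    using p by (rule prime_gt_0_nat)
  have ndvd: "\<not> q dvd p" if "q \<in> S" for q
    using S[OF that] p \<open>p \<notin> S\<close> that by (metis primes_dvd_imp_eq)
  have summ: "f summable_on B" for B
    using summable by (rule summable_on_subset_banach) auto
  have "bij_betw ((*) p) A {n\<in>A. p dvd n}"
    using \<open>p > 0\<close> ndvd S
    by (intro bij_betwI[where g = "\<lambda>n. n div p"])
       (auto simp: A_def prime_dvd_mult_iff elim!: dvdE)
  hence "infsum f {n\<in>A. p dvd n} = (\<Sum>\<^sub>\<infinity>n\<in>A. f p * f n)"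
    using infsum_reindex_bij_betw[of "(*) p" A "{n\<in>A. p dvd n}" f] by (simp add: mult)
  also have "\<dots> = f p * infsum f A"
    by (rule infsum_cmult_right) (rule summ)
  finally have mults: "infsum f {n\<in>A. p dvd n} = f p * infsum f A" .
  have "infsum f A = infsum f ({n\<in>A. p dvd n} \<union> {n\<in>A. \<not> p dvd n})"
    by (rule arg_cong[where f = "infsum f"]) auto
  also have "\<dots> = infsum f {n\<in>A. p dvd n} + infsum f {n\<in>A. \<not> p dvd n}"
    by (intro infsum_Un_disjoint summ) auto
  finally have "infsum f {n\<in>A. \<not> p dvd n} = (1 - f p) * infsum f A"
    by (simp add: mults algebra_simps)
  moreover have "{n\<in>A. \<not> p dvd n} = {n. n > 0 \<and> (\<forall>q\<in>insert p S. \<not> q dvd n)}"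
    by (auto simp: A_def)
  ultimately show ?case
    using insert.IH[OF S] insert.hyps by (simp add: A_def)
qed simp

text \<open>
  An integer without prime factors up to \<open>N\<close> is \<open>1\<close> or exceeds \<open>N\<close>, so the sieved sum differs
  from \<open>f 1\<close> by at most a tail of an absolutely convergent series. Multiplying by the factors
  \<open>1 - f p\<close> instead of dividing by them makes any discussion of infinite products and of
  zeros superfluous.
\<close>
lemma euler_product_tendsto:
  fixes f :: "nat \<Rightarrow> complex"
  assumes mult: "\<And>m n. f (m * n) = f m * f n" and one: "f 1 = 1"
    and summable: "summable (\<lambda>n. norm (f n))"
  shows "(\<lambda>N. (\<Prod>p | prime p \<and> p \<le> N. 1 - f p) * (\<Sum>\<^sub>\<infinity>n | n > 0. f n)) \<longlonglongrightarrow> 1"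
proof -
  have nsumm: "(\<lambda>n. norm (f n)) summable_on B" for B
    using summable by (intro summable_on_subset_banach[of _ UNIV B])
      (auto intro: norm_summable_imp_summable_on)
  have summ: "f summable_on B" for B
    using nsumm by (rule abs_summable_summable)
  define T where "T = (\<lambda>N. (\<Sum>n. norm (f (n + Suc N))))"
  have bound: "norm ((\<Prod>p | prime p \<and> p \<le> N. 1 - f p) * (\<Sum>\<^sub>\<infinity>n | n > 0. f n) - 1) \<le> T N" for N
  proof -
    define A where "A = {n. n > 0 \<and> (\<forall>p\<in>{p. prime p \<and> p \<le> N}. \<not> p dvd n)}"
    have "1 \<in> A"
      by (auto simp: A_def)
    have large: "n \<ge> Suc N" if n: "n \<in> A - {1}" for n
    proof -
      obtain p where p: "prime p" "p dvd n"
        using n prime_factor_nat[of n] by auto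
      hence "p > N"
        using n by (auto simp: A_def not_le)
      moreover have "p \<le> n"
        using p n by (auto simp: A_def intro: dvd_imp_le)
      ultimately show ?thesis
        by simp
    qed
    have "infsum f A = infsum f ({1} \<union> (A - {1}))"
      using \<open>1 \<in> A\<close> by (intro arg_cong[where f = "infsum f"]) auto
    also have "\<dots> = 1 + infsum f (A - {1})"
      by (subst infsum_Un_disjoint) (auto simp: summ one simp del: One_nat_def)
    finally have "norm (infsum f A - 1) = norm (infsum f (A - {1}))"
      by simp
    also have "\<dots> \<le> (\<Sum>\<^sub>\<infinity>n\<in>A - {1}. norm (f n))"
      by (intro norm_infsum_bound nsumm)
    also have "\<dots> \<le> (\<Sum>\<^sub>\<infinity>n\<in>{Suc N..}. norm (f n))"
      using large by (intro infsum_mono2 nsumm) auto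
    also have "\<dots> = (\<Sum>\<^sub>\<infinity>n\<in>UNIV. norm (f (n + Suc N)))"
      by (rule infsum_reindex_bij_witness[of _ "\<lambda>n. n + Suc N" "\<lambda>n. n - Suc N"]) auto
    also have "\<dots> = T N"
    proof -
      have "summable (\<lambda>n. norm (f (n + Suc N)))"
        using summable by (rule summable_ignore_initial_segment)
      hence "((\<lambda>n. norm (f (n + Suc N))) has_sum T N) UNIV"
        unfolding T_def by (intro sums_nonneg_imp_has_sum summable_sums) auto
      thus ?thesis
        by (rule infsumI)
    qed
    also have "infsum f A = (\<Prod>p | prime p \<and> p \<le> N. 1 - f p) * (\<Sum>\<^sub>\<infinity>n | n > 0. f n)"
      unfolding A_def by (rule infsum_coprime_to_primes[OF mult summ]) auto
    finally show ?thesis .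
  qed
  have "T \<longlonglongrightarrow> 0"
    unfolding T_def
    by (rule filterlim_compose[OF suminf_exist_split2[OF summable] filterlim_Suc])
  hence "(\<lambda>N. (\<Prod>p | prime p \<and> p \<le> N. 1 - f p) * (\<Sum>\<^sub>\<infinity>n | n > 0. f n) - 1) \<longlonglongrightarrow> 0"
    by (rule Lim_null_comparison[rotated]) (use bound in auto)
  thus ?thesis
    by (simp add: LIM_zero_iff)
qed

section \<open>Sums over primes from the size of the Dirichlet series\<close>

lemma summable_inverse_squares: "summable (\<lambda>n. 1 / real n ^ 2)"
  using inverse_power_summable[of 2, where 'a = real] by (simp add: inverse_eq_divide)

text \<open>
  This is \<open>Re log\<close> of the Euler product without logarithms of complex numbers: from
  \<open>\<bar>1 - z\<bar>\<^sup>2 = 1 - 2 Re z + \<bar>z\<bar>\<^sup>2 \<le> exp (\<bar>z\<bar>\<^sup>2 - 2 Re z)\<close> a large sum of \<open>Re (f p)\<close> makes the product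
  of the factors \<open>1 - f p\<close> small, while its product with the Dirichlet series tends to \<open>1\<close>.
\<close>
lemma prime_sum_le_ln_norm:
  fixes f :: "nat \<Rightarrow> complex"
  assumes mult: "\<And>m n. f (m * n) = f m * f n" and one: "f 1 = 1"
    and summable: "summable (\<lambda>n. norm (f n))"
    and small: "\<And>n. norm (f n) \<le> 1 / real n"
    and K: "norm (\<Sum>\<^sub>\<infinity>n | n > 0. f n) \<le> K"
  shows "\<forall>\<^sub>F N in sequentially. (\<Sum>p | prime p \<and> p \<le> N. Re (f p)) \<le> ln (2 * K) + (\<Sum>n. 1 / real n ^ 2)"
proof -
  define Z where "Z = (\<Sum>\<^sub>\<infinity>n | n > 0. f n)"
  define Q where "Q = (\<Sum>n. 1 / real n ^ 2)"
  have "(\<lambda>N. norm ((\<Prod>p | prime p \<and> p \<le> N. 1 - f p) * Z)) \<longlonglongrightarrow> norm (1 :: complex)"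
    unfolding Z_def by (intro tendsto_norm euler_product_tendsto mult one summable)
  hence "\<forall>\<^sub>F N in sequentially. norm ((\<Prod>p | prime p \<and> p \<le> N. 1 - f p) * Z) > 1 / 2"
    by (rule order_tendstoD) auto
  thus ?thesis
  proof eventually_elim
    case (elim N)
    define P where "P = {p::nat. prime p \<and> p \<le> N}"
    have fin: "finite P"
      by (simp add: P_def)
    have factor: "norm (1 - f p) \<le> exp (1 / real p ^ 2 - Re (f p))" for p
    proof (rule power2_le_imp_le)
      have "norm (1 - f p) ^ 2 = 1 + (norm (f p) ^ 2 - 2 * Re (f p))"
        unfolding cmod_power2 by (simp add: power2_eq_square algebra_simps)
      also have "\<dots> \<le> exp (norm (f p) ^ 2 - 2 * Re (f p))"
        by (rule exp_ge_add_one_self)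
      also have "\<dots> \<le> exp (2 * (1 / real p ^ 2 - Re (f p)))"
      proof -
        have "norm (f p) ^ 2 \<le> (1 / real p) ^ 2"
          by (intro power_mono small) auto
        also have "\<dots> \<le> 2 * (1 / real p ^ 2)"
          by (simp add: power_divide divide_right_mono)
        finally show ?thesis
          by simp
      qed
      also have "\<dots> = exp (1 / real p ^ 2 - Re (f p)) ^ 2"
        by (rule exp_double)
      finally show "norm (1 - f p) ^ 2 \<le> exp (1 / real p ^ 2 - Re (f p)) ^ 2" .
    qed auto
    have "norm (\<Prod>p\<in>P. 1 - f p) = (\<Prod>p\<in>P. norm (1 - f p))"
      by (rule prod_norm[symmetric])
    also have "\<dots> \<le> (\<Prod>p\<in>P. exp (1 / real p ^ 2 - Re (f p)))"
      by (intro prod_mono) (auto intro: factor)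
    also have "\<dots> = exp ((\<Sum>p\<in>P. 1 / real p ^ 2) - (\<Sum>p\<in>P. Re (f p)))"
      by (simp add: exp_sum[OF fin, symmetric] sum_subtractf)
    also have "(\<Sum>p\<in>P. 1 / real p ^ 2) \<le> Q"
      unfolding Q_def using fin
      by (intro sum_le_suminf) (auto simp: summable_inverse_squares)
    finally have prod: "norm (\<Prod>p\<in>P. 1 - f p) \<le> exp (Q - (\<Sum>p\<in>P. Re (f p)))"
      by simp
    have "1 / 2 < norm (\<Prod>p\<in>P. 1 - f p) * norm Z"
      using elim by (simp add: P_def norm_mult)
    also have "\<dots> \<le> exp (Q - (\<Sum>p\<in>P. Re (f p))) * K"
      using prod K by (intro mult_mono) (auto simp: Z_def)
    finally have *: "1 / 2 < exp (Q - (\<Sum>p\<in>P. Re (f p))) * K" .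
    hence "exp (Q - (\<Sum>p\<in>P. Re (f p))) * K > 0"
      by linarith
    hence "K > 0"
      by (simp add: zero_less_mult_iff)
    have "exp (\<Sum>p\<in>P. Re (f p)) < exp Q * (2 * K)"
      using * by (simp add: exp_diff field_simps)
    also have "\<dots> = exp (ln (2 * K) + Q)"
      using \<open>K > 0\<close> by (simp add: exp_add)
    finally show ?case
      by (simp add: P_def Q_def)
  qed
qed

text \<open>
  The opposite estimate for real nonnegative terms, from \<open>exp (- 2 y) \<le> 1 - y\<close> for
  \<open>0 \<le> y \<le> 1/2\<close>; the bound \<open>y \<le> 1/2\<close> is available because every prime is at least \<open>2\<close>.
\<close>
lemma prime_sum_ge_ln_norm:
  fixes f :: "nat \<Rightarrow> real"
  assumes mult: "\<And>m n. f (m * n) = f m * f n" and one: "f 1 = 1"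
    and summable: "summable f"
    and nonneg: "\<And>n. f n \<ge> 0" and small: "\<And>n. f n \<le> 1 / real n"
    and L: "L > 0" "L \<le> (\<Sum>n. f n)"
  shows "\<forall>\<^sub>F N in sequentially. ln (L / 2) / 2 \<le> (\<Sum>p | prime p \<and> p \<le> N. f p)"
proof -
  define Z where "Z = (\<Sum>\<^sub>\<infinity>n | n > 0. complex_of_real (f n))"
  have "f 0 = 0"
    using small[of 0] nonneg[of 0] by simp
  have "(f has_sum (\<Sum>n. f n)) UNIV"
    using summable nonneg by (intro sums_nonneg_imp_has_sum summable_sums)
  hence "((\<lambda>n. complex_of_real (f n)) has_sum of_real (\<Sum>n. f n)) UNIV"
    by (rule has_sum_of_real)
  also have "?this \<longleftrightarrow> ((\<lambda>n. complex_of_real (f n)) has_sum of_real (\<Sum>n. f n)) {n. n > 0}"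
    by (rule has_sum_cong_neutral) (auto simp: \<open>f 0 = 0\<close>)
  finally have Z: "Z = of_real (\<Sum>n. f n)"
    unfolding Z_def by (rule infsumI)
  have "(\<lambda>N. norm ((\<Prod>p | prime p \<and> p \<le> N. 1 - complex_of_real (f p)) * Z)) \<longlonglongrightarrow> norm (1 :: complex)"
    unfolding Z_def
    by (intro tendsto_norm euler_product_tendsto) (use mult one summable nonneg in auto)
  hence "\<forall>\<^sub>F N in sequentially. norm ((\<Prod>p | prime p \<and> p \<le> N. 1 - complex_of_real (f p)) * Z) < 2"
    by (rule order_tendstoD) auto
  thus ?thesis
  proof eventually_elim
    case (elim N)
    define P where "P = {p::nat. prime p \<and> p \<le> N}"
    have fin: "finite P"
      by (simp add: P_def)
    have factor: "exp (- 2 * f p) \<le> 1 - f p" if "p \<in> P" for p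
    proof -
      have "p \<ge> 2"
        using that by (auto simp: P_def dest: prime_ge_2_nat)
      hence "1 / real p \<le> 1 / 2"
        by (simp add: field_simps)
      hence fp: "f p \<le> 1 / 2"
        using small[of p] by linarith
      have "1 \<le> 1 + f p * (1 - 2 * f p)"
        using fp nonneg[of p] by simp
      also have "\<dots> = (1 - f p) * (1 + 2 * f p)"
        by (simp add: algebra_simps)
      also have "\<dots> \<le> (1 - f p) * exp (2 * f p)"
        using fp by (intro mult_left_mono exp_ge_add_one_self) auto
      finally show ?thesis
        by (simp add: exp_minus field_simps)
    qed
    have "exp (- 2 * (\<Sum>p\<in>P. f p)) = (\<Prod>p\<in>P. exp (- 2 * f p))"
      by (simp add: exp_sum[OF fin, symmetric] sum_distrib_left sum_negf)
    also have "\<dots> \<le> (\<Prod>p\<in>P. 1 - f p)"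
      by (intro prod_mono conjI factor) auto
    finally have prod: "exp (- 2 * (\<Sum>p\<in>P. f p)) \<le> (\<Prod>p\<in>P. 1 - f p)" .
    have "exp (- 2 * (\<Sum>p\<in>P. f p)) * L \<le> (\<Prod>p\<in>P. 1 - f p) * (\<Sum>n. f n)"
      using prod L by (intro mult_mono) (auto intro: order_trans[OF _ prod])
    also have "(\<Prod>p\<in>P. 1 - complex_of_real (f p)) * Z = of_real ((\<Prod>p\<in>P. 1 - f p) * (\<Sum>n. f n))"
      by (simp add: Z)
    hence "(\<Prod>p\<in>P. 1 - f p) * (\<Sum>n. f n) \<le> norm ((\<Prod>p\<in>P. 1 - complex_of_real (f p)) * Z)"
      by (simp only: norm_of_real)
    also have "\<dots> < 2"
      using elim by (simp add: P_def)
    finally have "L / 2 < exp (2 * (\<Sum>p\<in>P. f p))"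
      by (simp add: exp_minus field_simps)
    hence "ln (L / 2) < 2 * (\<Sum>p\<in>P. f p)"
      using L by (subst (asm) ln_less_cancel_iff[symmetric]) auto
    thus ?case
      by (simp add: P_def)
  qed
qed

section \<open>The zeta function to the right of the line of real part one\<close>

text \<open>
  Multiplying the partial sum of \<open>\<zeta>(w)\<close> by \<open>1 - w\<close> turns it, up to second-order Taylor
  errors, into the telescoping sum of the differences of \<open>n powr (1 - w)\<close>. The errors are
  \<open>O(n powr - 2)\<close> uniformly in \<open>s\<close>, and \<open>\<bar>w - 1\<bar> \<ge> \<bar>t\<bar>\<close> allows dividing by \<open>w - 1\<close>. No
  analytic continuation is involved.
\<close>
lemma zeta_bounded_above_one:
  fixes t :: real
  assumes "t \<noteq> 0"
  shows "\<exists>K. \<forall>s. 1 < s \<and> s \<le> 2 \<longrightarrow> norm (\<Sum>\<^sub>\<infinity>n | n > 0. of_nat n powr - Complex s t) \<le> K"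
proof -
  define Q where "Q = (\<Sum>n. 1 / real n ^ 2)"
  define K where "K = (2 + (1 + \<bar>t\<bar>) * (2 + \<bar>t\<bar>) * Q) / \<bar>t\<bar>"
  have "Q \<ge> 0"
    unfolding Q_def
    by (intro suminf_nonneg) (auto simp: summable_inverse_squares)
  have "norm (\<Sum>\<^sub>\<infinity>n | n > 0. of_nat n powr - w) \<le> K" if s: "1 < s" "s \<le> 2" and w: "w = Complex s t" for s w
  proof -
    have Rew: "Re w = s"
      by (simp add: w)
    have w_bounds: "norm w \<le> 2 + \<bar>t\<bar>" "norm (w - 1) \<le> 1 + \<bar>t\<bar>" "\<bar>t\<bar> \<le> norm (w - 1)"
      using cmod_le[of w] cmod_le[of "w - 1"] abs_Im_le_cmod[of "w - 1"] s by (auto simp: w)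
    \<comment> \<open>The error of the first-order Taylor expansion of \<open>z powr (1 - w)\<close> at \<open>n\<close>, evaluated at
      \<open>n + 1\<close>.\<close>
    define r where "r = (\<lambda>n. of_nat (Suc n) powr (1 - w) - of_nat n powr (1 - w) - (1 - w) * of_nat n powr - w)"
    have r: "norm (r n) \<le> (1 + \<bar>t\<bar>) * (2 + \<bar>t\<bar>) * (1 / real n ^ 2)" if n: "n > 0" for n
    proof -
      define S where "S = closed_segment (of_nat n :: complex) (of_nat (Suc n))"
      define g where "g = (\<lambda>i z. if i = 0 then z powr (1 - w) else
          if i = Suc 0 then (1 - w) * z powr - w else (1 - w) * (- w) * z powr (- w - 1))"
      have S: "\<exists>x\<ge>real n. z = of_real x" if "z \<in> S" for z
      proof -
        have "closed_segment (complex_of_real (real n)) (complex_of_real (real (Suc n))) = 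
              of_real ` closed_segment (real n) (real (Suc n))"
          by (rule closed_segment_of_real)
        thus ?thesis
          using that by (auto simp: S_def closed_segment_eq_real_ivl)
      qed
      have "norm (g 0 (of_nat (Suc n)) - (\<Sum>i\<le>1. g i (of_nat n) * (of_nat (Suc n) - of_nat n) ^ i / fact i))
          \<le> ((1 + \<bar>t\<bar>) * (2 + \<bar>t\<bar>) * (1 / real n ^ 2)) * norm (of_nat (Suc n) - of_nat n :: complex) ^ Suc 1 / fact 1"
      proof (rule complex_Taylor)
        show "convex S"
          by (simp add: S_def)
        show "of_nat n \<in> S" "of_nat (Suc n) \<in> S"
          by (auto simp: S_def simp del: of_nat_Suc)
        show "(g i has_field_derivative g (Suc i) z) (at z within S)" if z: "z \<in> S" and i: "i \<le> 1" for i z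
        proof -
          obtain x where x: "x \<ge> real n" "z = of_real x"
            using S[OF z] by blast
          hence nonpos: "z \<notin> \<real>\<^sub>\<le>\<^sub>0"
            using n by auto
          have "i = 0 \<or> i = Suc 0"
            using i by auto
          thus ?thesis
            using has_field_derivative_powr[OF nonpos, of "1 - w"]
              DERIV_cmult[OF has_field_derivative_powr[OF nonpos, of "- w"], of "1 - w"]
            by (auto simp: g_def mult.assoc intro: has_field_derivative_at_within)
        qed
        show "cmod (g (Suc 1) z) \<le> (1 + \<bar>t\<bar>) * (2 + \<bar>t\<bar>) * (1 / real n ^ 2)" if z: "z \<in> S" for z
        proof -
          obtain x where x: "x \<ge> real n" "z = of_real x"
            using S[OF z] by blast
          have "norm (z powr (- w - 1)) = x powr (- s - 1)"
            using x n by (simp add: norm_powr_real_powr Rew)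
          also have "\<dots> \<le> x powr (- 2)"
            using x n s by (intro powr_mono) auto
          also have "\<dots> = 1 / x ^ 2"
            using x n by (simp add: powr_minus powr_numeral field_simps)
          also have "\<dots> \<le> 1 / real n ^ 2"
            using x n by (intro divide_left_mono power_mono) auto
          finally have "norm (z powr (- w - 1)) \<le> 1 / real n ^ 2" .
          hence "norm (w - 1) * norm w * norm (z powr (- w - 1)) \<le> (1 + \<bar>t\<bar>) * (2 + \<bar>t\<bar>) * (1 / real n ^ 2)"
            using w_bounds by (intro mult_mono) auto
          thus ?thesis
            by (simp add: g_def norm_mult norm_minus_commute[of 1 w])
        qed
      qed
      thus ?thesis
        by (simp add: r_def g_def algebra_simps)
    qed
    \<comment> \<open>The term at \<open>n = 0\<close> vanishes because \<open>0 powr - w = 0\<close>.\<close>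
    have "norm (\<Sum>n<N. of_nat n powr - w) \<le> K" for N
    proof (cases "N = 0")
      case True
      thus ?thesis using \<open>Q \<ge> 0\<close> by (simp add: K_def)
    next
      case False
      have "(\<Sum>n=1..<N. r n) = of_nat N powr (1 - w) - 1 - (1 - w) * (\<Sum>n=1..<N. of_nat n powr - w)"
        using False sum_Suc_diff'[of 1 N "\<lambda>n. of_nat n powr (1 - w)"]
        by (simp add: r_def sum_subtractf sum_distrib_left)
      moreover have "(\<Sum>n<N. of_nat n powr - w) = (\<Sum>n=1..<N. of_nat n powr - w)"
        using False by (intro sum.mono_neutral_right) (auto simp: not_less_eq_eq)
      ultimately have eq: "(w - 1) * (\<Sum>n<N. of_nat n powr - w) = 1 - of_nat N powr (1 - w) + (\<Sum>n=1..<N. r n)"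
        by (simp add: algebra_simps)
      have "norm (of_nat N powr (1 - w)) = real N powr (1 - s)"
        by (simp add: norm_powr_real_powr Rew)
      also have "\<dots> \<le> real N powr 0"
        using False s by (intro powr_mono) auto
      finally have N1: "norm (of_nat N powr (1 - w)) \<le> 1"
        using False by simp
      have "norm (\<Sum>n=1..<N. r n) \<le> (\<Sum>n=1..<N. (1 + \<bar>t\<bar>) * (2 + \<bar>t\<bar>) * (1 / real n ^ 2))"
        by (intro sum_norm_le r) auto
      also have "\<dots> = (1 + \<bar>t\<bar>) * (2 + \<bar>t\<bar>) * (\<Sum>n=1..<N. 1 / real n ^ 2)"
        by (rule sum_distrib_left[symmetric])
      also have "\<dots> \<le> (1 + \<bar>t\<bar>) * (2 + \<bar>t\<bar>) * Q"
        unfolding Q_def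
        by (intro mult_left_mono sum_le_suminf) (auto simp: summable_inverse_squares)
      finally have "norm (\<Sum>n=1..<N. r n) \<le> (1 + \<bar>t\<bar>) * (2 + \<bar>t\<bar>) * Q" .
      moreover have "norm (1 - of_nat N powr (1 - w) + (\<Sum>n=1..<N. r n)) \<le> norm (1::complex) + norm (of_nat N powr (1 - w)) + norm (\<Sum>n=1..<N. r n)"
        by (rule order_trans[OF norm_triangle_ineq add_right_mono[OF norm_triangle_ineq4]])
      ultimately have "norm ((w - 1) * (\<Sum>n<N. of_nat n powr - w)) \<le> 2 + (1 + \<bar>t\<bar>) * (2 + \<bar>t\<bar>) * Q"
        using N1 eq by simp
      moreover have "\<bar>t\<bar> * norm (\<Sum>n<N. of_nat n powr - w) \<le> norm ((w - 1) * (\<Sum>n<N. of_nat n powr - w))"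
        using w_bounds by (simp add: norm_mult mult_right_mono)
      ultimately show ?thesis
        using assms by (simp add: K_def field_simps)
    qed
    moreover have "(\<lambda>N. \<Sum>n<N. of_nat n powr - w) \<longlonglongrightarrow> (\<Sum>\<^sub>\<infinity>n | n > 0. of_nat n powr - w)"
    proof -
      have "summable (\<lambda>n. norm (of_nat n powr - w))"
        using s by (simp add: norm_powr_real_powr Rew summable_real_powr_iff)
      hence "(\<lambda>n. of_nat n powr - w) summable_on {n. n > 0}"
        by (intro summable_on_subset_banach[of _ UNIV "{n. n > 0}"] norm_summable_imp_summable_on) auto
      hence "((\<lambda>n. of_nat n powr - w) has_sum (\<Sum>\<^sub>\<infinity>n | n > 0. of_nat n powr - w)) {n. n > 0}"
        by (rule has_sum_infsum)
      also have "?this \<longleftrightarrow> ((\<lambda>n. of_nat n powr - w) has_sum (\<Sum>\<^sub>\<infinity>n | n > 0. of_nat n powr - w)) UNIV"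
        by (rule has_sum_cong_neutral) auto
      finally show ?thesis
        using has_sum_imp_sums sums_def by blast
    qed
    ultimately show ?thesis
      by (intro Lim_norm_ubound[OF trivial_limit_sequentially]) auto
  qed
  thus ?thesis
    by blast
qed

text \<open>
  A partial harmonic sum exceeding \<open>L\<close> still does so after its exponent is moved slightly to the
  right of \<open>1\<close>.
\<close>
lemma zeta_unbounded_above_one:
  fixes L :: real
  shows "\<exists>s. 1 < s \<and> s \<le> 2 \<and> L \<le> (\<Sum>n. real n powr - s)"
proof -
  obtain N where N: "harm N > L"
    using harm_at_top[unfolded filterlim_at_top_dense] eventually_happens'[OF sequentially_bot] by blast
  have "((\<lambda>s. \<Sum>n=1..N. real n powr - s) \<longlongrightarrow> (\<Sum>n=1..N. real n powr - 1)) (at_right 1)"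
    by (intro tendsto_intros) auto
  also have "(\<Sum>n=1..N. real n powr - 1) = harm N"
    by (simp add: harm_def powr_minus)
  finally have "\<forall>\<^sub>F s in at_right 1. (\<Sum>n=1..N. real n powr - s) > L"
    using N by (rule order_tendstoD)
  moreover have "\<forall>\<^sub>F s in at_right 1. s \<in> {1<..<2::real}"
    by (rule eventually_at_right_real) auto
  ultimately have "\<forall>\<^sub>F s in at_right 1. s \<in> {1<..<2::real} \<and> (\<Sum>n=1..N. real n powr - s) > L"
    by eventually_elim auto
  then obtain s where s: "1 < s" "s < 2" "(\<Sum>n=1..N. real n powr - s) > L"
    using eventually_happens'[of "at_right (1::real)"] by (auto simp: trivial_limit_at_right_real)
  have "summable (\<lambda>n. real n powr - s)"
    using s by (simp add: summable_real_powr_iff)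
  hence "(\<Sum>n=1..N. real n powr - s) \<le> (\<Sum>n. real n powr - s)"
    by (intro sum_le_suminf) auto
  with s show ?thesis
    by (intro exI[of _ s]) auto
qed

lemma Re_of_nat_powr_Complex:
  assumes "n > 0"
  shows "Re (of_nat n powr Complex a b) = real n powr a * cos (b * ln (real n))"
proof -
  have "of_nat n powr Complex a b = exp (Complex a b * complex_of_real (ln (real n)))"
    using assms by (rule of_nat_powr_eq_exp_ln)
  thus ?thesis
    using assms by (simp add: Re_exp powr_def mult.commute)
qed

section \<open>Primes at which the cosine is positive\<close>

text \<open>
  The real part of \<open>p powr - (s + i t)\<close> is the summand here, so this is the bound on \<open>\<zeta>(s + i t)\<close>
  read through the Euler product. Only an upper bound holds so cheaply: a lower bound would amount to
  the non-vanishing of \<open>\<zeta>\<close> at \<open>1 + i t\<close>. How large \<open>N\<close> must be may depend on \<open>s\<close>, but \<open>U\<close> does not.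
\<close>
lemma prime_cos_sum_bounded_above:
  fixes t :: real
  assumes "t \<noteq> 0"
  shows "\<exists>U. \<forall>s. 1 < s \<and> s \<le> 2 \<longrightarrow>
    (\<forall>\<^sub>F N in sequentially. (\<Sum>p | prime p \<and> p \<le> N. real p powr - s * cos (t * ln (real p))) \<le> U)"
proof -
  obtain K where K: "\<And>s. 1 < s \<Longrightarrow> s \<le> 2 \<Longrightarrow> norm (\<Sum>\<^sub>\<infinity>n | n > 0. of_nat n powr - Complex s t) \<le> K"
    using zeta_bounded_above_one[OF assms] by blast
  have "\<forall>\<^sub>F N in sequentially. (\<Sum>p | prime p \<and> p \<le> N. real p powr - s * cos (t * ln (real p)))
      \<le> ln (2 * K) + (\<Sum>n. 1 / real n ^ 2)" if s: "1 < s" "s \<le> 2" for s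
  proof -
    have "\<forall>\<^sub>F N in sequentially. (\<Sum>p | prime p \<and> p \<le> N. Re (of_nat p powr - Complex s t))
      \<le> ln (2 * K) + (\<Sum>n. 1 / real n ^ 2)"
    proof (rule prime_sum_le_ln_norm)
      show "of_nat (m * n) powr - Complex s t = of_nat m powr - Complex s t * of_nat n powr - Complex s t" for m n
        by (simp add: powr_times_real_left)
      show "summable (\<lambda>n. norm (of_nat n powr - Complex s t :: complex))"
        using s by (simp add: norm_powr_real_powr summable_real_powr_iff)
      show "norm (of_nat n powr - Complex s t :: complex) \<le> 1 / real n" for n
      proof (cases "n = 0")
        case False
        have "real n powr - s \<le> real n powr - 1"
          using False s by (intro powr_mono) auto
        also have "real n powr - s = norm (of_nat n powr - Complex s t :: complex)"
          by (simp add: norm_powr_real_powr)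
        finally show ?thesis
          by (simp add: powr_minus_divide[of _ 1])
      qed simp
    qed (use K[OF s] in auto)
    also have "(\<lambda>N. \<Sum>p | prime p \<and> p \<le> N. Re (of_nat p powr - Complex s t)) =
        (\<lambda>N. \<Sum>p | prime p \<and> p \<le> N. real p powr - s * cos (t * ln (real p)))"
    proof (intro ext sum.cong refl)
      fix N p :: nat assume "p \<in> {p. prime p \<and> p \<le> N}"
      hence "p > 0"
        by (auto dest: prime_gt_0_nat)
      moreover have "- Complex s t = Complex (- s) (- t)"
        by (simp add: complex_eq_iff)
      ultimately show "Re (of_nat p powr - Complex s t) = real p powr - s * cos (t * ln (real p))"
        using Re_of_nat_powr_Complex[of p "-s" "-t"] by simp
    qed
    finally show ?thesis .
  qed
  thus ?thesis
    by blast
qed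

text \<open>
  Euler's proof that the reciprocals of the primes have a divergent sum, kept to the right of \<open>1\<close> so
  that it can be compared with the oscillating sums at the same \<open>s\<close>.
\<close>
lemma prime_sum_powr_unbounded:
  fixes U :: real
  shows "\<exists>s. 1 < s \<and> s \<le> 2 \<and> (\<forall>\<^sub>F N in sequentially. U \<le> (\<Sum>p | prime p \<and> p \<le> N. real p powr - s))"
proof -
  obtain s where s: "1 < s" "s \<le> 2" "2 * exp (2 * U) \<le> (\<Sum>n. real n powr - s)"
    using zeta_unbounded_above_one by blast
  have "\<forall>\<^sub>F N in sequentially. ln (2 * exp (2 * U) / 2) / 2 \<le> (\<Sum>p | prime p \<and> p \<le> N. real p powr - s)"
  proof (rule prime_sum_ge_ln_norm)
    show "real n powr - s \<le> 1 / real n" for n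
    proof (cases "n = 0")
      case False
      have "real n powr - s \<le> real n powr - 1"
        using False s by (intro powr_mono) auto
      thus ?thesis
        by (simp add: powr_minus_divide)
    qed simp
  qed (use s in \<open>auto simp: powr_mult summable_real_powr_iff\<close>)
  thus ?thesis
    using s by auto
qed

text \<open>
  Suppose the sums stay below \<open>M\<close>. Weight the inequality \<open>trig_majorant\<close> at \<open>b * ln p\<close> with
  \<open>p powr - s\<close> and sum over primes: the left side is unbounded as \<open>s\<close> approaches \<open>1\<close>, while on
  the right the four oscillating sums are bounded above (this is where the positivity of their
  coefficients enters) and the remaining one is at most \<open>100 * M\<close>. The case \<open>b = 0\<close>, without
  oscillation, is the divergence of the sum of the prime reciprocals itself.
\<close>
theorem prime_positive_cos_sum_unbounded:
  fixes b M :: real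
  shows "\<exists>N. M < (\<Sum>p | prime p \<and> p \<le> N. max 0 (cos (b * ln (real p))) / real p)"
proof (rule ccontr)
  define P where "P = (\<lambda>N. {p::nat. prime p \<and> p \<le> N})"
  assume "\<not> ?thesis"
  hence M: "(\<Sum>p\<in>P N. max 0 (cos (b * ln (real p))) / real p) \<le> M" for N
    by (auto simp: not_less P_def)
  have pos: "p > 0" if "p \<in> P N" for p N
    using that by (auto simp: P_def dest: prime_gt_0_nat)
  have M': "(\<Sum>p\<in>P N. real p powr - s * max 0 (cos (b * ln (real p)))) \<le> M" if s: "1 < s" for N s
  proof -
    have "(\<Sum>p\<in>P N. real p powr - s * max 0 (cos (b * ln (real p)))) \<le> (\<Sum>p\<in>P N. max 0 (cos (b * ln (real p))) / real p)"
    proof (rule sum_mono)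
      fix p assume "p \<in> P N"
      hence "real p powr - s \<le> real p powr - 1"
        using s pos[of p N] by (intro powr_mono) auto
      hence "real p powr - s * max 0 (cos (b * ln (real p))) \<le> 1 / real p * max 0 (cos (b * ln (real p)))"
        by (intro mult_right_mono) (auto simp: powr_minus_divide)
      thus "real p powr - s * max 0 (cos (b * ln (real p))) \<le> max 0 (cos (b * ln (real p))) / real p"
        by simp
    qed
    thus ?thesis
      using M[of N] by linarith
  qed
  show False
  proof (cases "b = 0")
    case True
    obtain s where s: "1 < s" "\<forall>\<^sub>F N in sequentially. M + 1 \<le> (\<Sum>p\<in>P N. real p powr - s)"
      using prime_sum_powr_unbounded unfolding P_def by blast
    then obtain N where "M + 1 \<le> (\<Sum>p\<in>P N. real p powr - s)"
      using eventually_happens'[OF sequentially_bot] by blast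
    thus False
      using M'[OF s(1), of N] True by simp
  next
    case False
    define C where "C = (\<lambda>k s N. \<Sum>p\<in>P N. real p powr - s * cos (k * (b * ln (real p))))"
    have "\<exists>U. \<forall>s. 1 < s \<and> s \<le> 2 \<longrightarrow> (\<forall>\<^sub>F N in sequentially. C k s N \<le> U)" if "k \<noteq> 0" for k
      using prime_cos_sum_bounded_above[of "k * b"] that False by (simp add: C_def P_def mult.assoc)
    then obtain U where U: "\<And>k s. k \<noteq> 0 \<Longrightarrow> 1 < s \<Longrightarrow> s \<le> 2 \<Longrightarrow> \<forall>\<^sub>F N in sequentially. C k s N \<le> U k"
      by metis
    define B where "B = 5 * U 2 + 8 * U 3 + 6 * U 4 + 2 * U 5 + 100 * M"
    obtain s where s: "1 < s" "s \<le> 2" "\<forall>\<^sub>F N in sequentially. B + 1 \<le> (\<Sum>p\<in>P N. real p powr - s)"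
      using prime_sum_powr_unbounded unfolding P_def by blast
    have "\<forall>\<^sub>F N in sequentially. B + 1 \<le> B"
      using U[of 2, OF _ s(1,2), simplified] U[of 3, OF _ s(1,2), simplified]
        U[of 4, OF _ s(1,2), simplified] U[of 5, OF _ s(1,2), simplified] s(3)
    proof eventually_elim
      case (elim N)
      have "(\<Sum>p\<in>P N. real p powr - s) \<le> (\<Sum>p\<in>P N. real p powr - s *
          (5 * cos (2 * (b * ln (real p))) + 8 * cos (3 * (b * ln (real p))) + 6 * cos (4 * (b * ln (real p)))
           + 2 * cos (5 * (b * ln (real p))) + 100 * max 0 (cos (b * ln (real p)))))"
        using mult_left_mono[OF trig_majorant] by (intro sum_mono) fastforce
      also have "\<dots> = 5 * C 2 s N + 8 * C 3 s N + 6 * C 4 s N + 2 * C 5 s N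
           + 100 * (\<Sum>p\<in>P N. real p powr - s * max 0 (cos (b * ln (real p))))"
        by (simp add: C_def sum_distrib_left sum.distrib [symmetric] algebra_simps)
      also have "\<dots> \<le> B"
        unfolding B_def using elim M'[OF s(1), of N] by (intro add_mono mult_left_mono) auto
      finally show ?case
        using elim by linarith
    qed
    thus False
      by simp
  qed
qed

section \<open>The range of the divisor function\<close>

text \<open>
  The divisors of \<open>p * m\<close> with \<open>p\<close> not dividing \<open>m\<close> are the divisors of \<open>m\<close> and \<open>p\<close> times these.
\<close>
lemma divisor_sigma_prod_primes:
  assumes "finite S" "\<And>p. p \<in> S \<Longrightarrow> prime p"
  shows "divisor_sigma c (\<Prod>S) = (\<Prod>p\<in>S. 1 + of_nat p powr c)"
  using assms
proof (induction S rule: finite_induct)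
  case empty
  show ?case
    by (simp add: divisor_sigma_def)
next
  case (insert p S)
  define m where "m = \<Prod>S"
  have p: "prime p" and S: "\<And>q. q \<in> S \<Longrightarrow> prime q"
    using insert.prems by auto
  have "p > 0"
    using p by (rule prime_gt_0_nat)
  have "m > 0"
    unfolding m_def using S by (intro prod_pos) (auto dest: prime_gt_0_nat)
  have "\<not> p dvd m"
    unfolding m_def using insert.hyps p S by (metis prime_dvd_prod_iff primes_dvd_imp_eq)
  have divisors: "{d. d dvd p * m} = {d. d dvd m} \<union> (*) p ` {d. d dvd m}"
  proof (intro equalityI subsetI)
    fix d assume "d \<in> {d. d dvd p * m}"
    hence d: "d dvd p * m"
      by simp
    show "d \<in> {d. d dvd m} \<union> (*) p ` {d. d dvd m}"
    proof (cases "p dvd d")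
      case True
      thus ?thesis
        using d \<open>p > 0\<close> by (auto elim!: dvdE[of p d])
    next
      case False
      hence "coprime d p"
        using prime_imp_coprime[of p d] p by (simp add: coprime_commute)
      thus ?thesis
        using d by (simp add: coprime_dvd_mult_right_iff)
    qed
  qed auto
  have "divisor_sigma c (p * m) = divisor_sigma c m + (\<Sum>d\<in>(*) p ` {d. d dvd m}. of_nat d powr c)"
    unfolding divisor_sigma_def divisors
    using \<open>m > 0\<close> \<open>\<not> p dvd m\<close> by (intro sum.union_disjoint) (auto dest: dvd_mult_left)
  also have "(\<Sum>d\<in>(*) p ` {d. d dvd m}. of_nat d powr c) = (\<Sum>d | d dvd m. of_nat (p * d) powr c)"
    using \<open>p > 0\<close> by (subst sum.reindex) (auto simp: inj_on_def)
  also have "\<dots> = of_nat p powr c * divisor_sigma c m"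
    by (simp add: divisor_sigma_def sum_distrib_left powr_times_real_left)
  finally show ?case
    using insert.IH[OF S] insert.hyps by (simp add: m_def algebra_simps)
qed

lemma one_plus_sum_le_prod:
  fixes x :: "'a \<Rightarrow> real"
  assumes "finite S" "\<And>i. i \<in> S \<Longrightarrow> x i \<ge> 0"
  shows "1 + sum x S \<le> (\<Prod>i\<in>S. 1 + x i)"
  using assms
proof (induction S rule: finite_induct)
  case (insert i S)
  have "1 + sum x (insert i S) \<le> (1 + x i) * (1 + sum x S)"
    using insert by (simp add: algebra_simps sum_nonneg)
  also have "\<dots> \<le> (1 + x i) * (\<Prod>i\<in>S. 1 + x i)"
    using insert by (intro mult_left_mono) auto
  finally show ?case
    using insert by simp
qed simp

theorem theorem2p1:
  fixes c :: complex and a :: real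
  assumes "Re c = a"
  shows "bounded (sigma_range c) \<longleftrightarrow> a < -1"
proof
  assume "a < -1"
  hence summ: "summable (\<lambda>d. real d powr a)"
    by (simp add: summable_real_powr_iff)
  have "norm (divisor_sigma c n) \<le> (\<Sum>d. real d powr a)" if "n > 0" for n
  proof -
    have "norm (divisor_sigma c n) \<le> (\<Sum>d | d dvd n. real d powr a)"
      unfolding divisor_sigma_def using assms
      by (intro sum_norm_le) (auto simp: norm_powr_real_powr)
    also have "\<dots> \<le> (\<Sum>d. real d powr a)"
      using summ that by (intro sum_le_suminf) auto
    finally show ?thesis .
  qed
  thus "bounded (sigma_range c)"
    unfolding bounded_iff sigma_range_def by blast
next
  assume "bounded (sigma_range c)"
  then obtain M where M: "\<And>n. n > 0 \<Longrightarrow> norm (divisor_sigma c n) \<le> M"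
    unfolding bounded_iff sigma_range_def by blast
  show "a < -1"
  proof (rule ccontr)
    assume "\<not> a < -1"
    define x where "x = (\<lambda>p. cos (Im c * ln (real p)))"
    obtain N where N: "M < (\<Sum>p | prime p \<and> p \<le> N. max 0 (x p) / real p)"
      using prime_positive_cos_sum_unbounded unfolding x_def by blast
    \<comment> \<open>At the primes in \<open>S\<close> the real part of \<open>p powr c\<close> is positive, so the factors
      \<open>1 + p powr c\<close> all have modulus above \<open>1\<close> and cannot cancel each other's growth.\<close>
    define S where "S = {p. prime p \<and> p \<le> N \<and> x p > 0}"
    have fin: "finite S"
      by (rule finite_subset[of _ "{..N}"]) (auto simp: S_def)
    have factor: "1 + x p / real p \<le> norm (1 + of_nat p powr c)" if "p \<in> S" for p
    proof -
      have p: "p > 0" "x p > 0"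
        using that by (auto simp: S_def dest: prime_gt_0_nat)
      have "x p / real p = real p powr - 1 * x p"
        using p by (simp add: powr_minus_divide)
      also have "\<dots> \<le> real p powr a * x p"
        using p \<open>\<not> a < -1\<close> by (intro mult_right_mono powr_mono) auto
      also have "\<dots> = Re (of_nat p powr c)"
        using Re_of_nat_powr_Complex[OF p(1), of "Re c" "Im c"]
        by (simp add: x_def assms[symmetric])
      finally have "1 + x p / real p \<le> Re (1 + of_nat p powr c)"
        by simp
      also have "\<dots> \<le> norm (1 + of_nat p powr c)"
        by (rule complex_Re_le_cmod)
      finally show ?thesis .
    qed
    have "(\<Sum>p | prime p \<and> p \<le> N. max 0 (x p) / real p) = (\<Sum>p\<in>S. x p / real p)"
      by (rule sum.mono_neutral_cong_right) (auto simp: S_def max_def)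
    also have "\<dots> \<le> 1 + (\<Sum>p\<in>S. x p / real p)"
      by simp
    also have "\<dots> \<le> (\<Prod>p\<in>S. 1 + x p / real p)"
      by (rule one_plus_sum_le_prod[OF fin]) (auto simp: S_def)
    also have "\<dots> \<le> (\<Prod>p\<in>S. norm (1 + of_nat p powr c))"
      by (intro prod_mono conjI factor) (auto simp: S_def intro!: add_nonneg_nonneg)
    also have "\<dots> = norm (divisor_sigma c (\<Prod>S))"
      by (subst divisor_sigma_prod_primes[OF fin]) (auto simp: S_def prod_norm)
    also have "\<dots> \<le> M"
      by (intro M prod_pos) (auto simp: S_def dest: prime_gt_0_nat)
    finally show False
      using N by simp
  qed
qed

end
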